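(* Consider the homogeneous complete network with $M\ge2$ nodes, external rates $p_j=p$ for all $j$, and internal rates $q_{i,j}=\frac{q}{M-1}$ for all $i\neq j$. Then the expected fraction of adopters $f(t)$ satisfies $$f'(0)=p,\qquad f''(0)=p(q-p),\qquad f'''(0)=p\Big(p^2-4pq+\frac{M-3}{M-1}q^2\Big).$$
   Context: Discrete Bass model: a network has $M$ nodes, external rates $p_j\ge 0$ and internal rates $q_{i,j}\ge 0$ ($i\ne j$; the influence of $i$ on $j$). $X_j(t)\in\{0,1\}$ is the state of node $j$ ($1$ = adopter), $X_j(0)=0$ for all $j$. The process $(X_1,\dots,X_M)$ is a continuous-time Markov chain in which adopters remain adopters forever, and each nonadopter $j$ becomes an adopter at rate $p_j+\sum_{k\ne j}q_{k,j}X_k(t)$ (one node changes at a time). The expected fraction of adopters is $f(t)=\frac1M\,\mathbf{E}\big[\sum_{j=1}^M X_j(t)\big]$. Derivatives at $t=0$ are one-sided. *)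

theory Defs
  imports "HOL-Probability.Probability"
begin

text \<open>
  A time-homogeneous continuous-time Markov chain with finite state space and jump rates
  \<open>r x y\<close> for \<open>x \<noteq> y\<close> (the diagonal of \<open>r\<close> is not used). \<open>K h x y\<close> is the transition
  probability from \<open>x\<close> to \<open>y\<close> over a time span \<open>h\<close>; that it also gives the conditional
  probability when states at finitely many earlier times \<open>T\<close> are prescribed is the Markov
  property. Since \<open>cond_prob\<close> is 0 on null conditions, these are excluded. Only times
  \<open>t \<ge> 0\<close> are meaningful. No regularity of the sample paths is required.
\<close>

locale finite_ctmc = prob_space \<Omega> for \<Omega> :: "'w measure" +
  fixes X :: "real \<Rightarrow> 'w \<Rightarrow> 's::finite"
    and r :: "'s \<Rightarrow> 's \<Rightarrow> real"
  assumes measurable_state: "t \<ge> 0 \<Longrightarrow> X t \<in> \<Omega> \<rightarrow>\<^sub>M count_space UNIV"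
    and transition_rates:
      "\<exists>K :: real \<Rightarrow> 's \<Rightarrow> 's \<Rightarrow> real.
         (\<forall>s\<ge>0. \<forall>h\<ge>0. \<forall>T z x y.
            finite T \<longrightarrow> T \<subseteq> {0..s} \<longrightarrow>
            \<P>(\<omega> in \<Omega>. X s \<omega> = x \<and> (\<forall>u\<in>T. X u \<omega> = z u)) > 0 \<longrightarrow>
            \<P>(\<omega> in \<Omega>. X (s + h) \<omega> = y \<bar> X s \<omega> = x \<and> (\<forall>u\<in>T. X u \<omega> = z u)) = K h x y) \<and>
         (\<forall>x y. x \<noteq> y \<longrightarrow> ((\<lambda>h. K h x y / h) \<longlongrightarrow> r x y) (at_right 0))"

text \<open>
  A state of the network is a function \<open>x\<close> on the nodes, with \<open>x j\<close> true iff \<open>j\<close> is an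
  adopter. The outer sum has one summand if \<open>y\<close> arises from \<open>x\<close> by exactly one nonadopter
  becoming an adopter, and is empty otherwise.
\<close>

definition bass_rate ::
    "('v::finite \<Rightarrow> real) \<Rightarrow> ('v \<Rightarrow> 'v \<Rightarrow> real) \<Rightarrow> ('v \<Rightarrow> bool) \<Rightarrow> ('v \<Rightarrow> bool) \<Rightarrow> real" where
  "bass_rate p q x y =
     (\<Sum>j | \<not> x j \<and> y = x(j := True). p j + (\<Sum>k | k \<noteq> j. q k j * of_bool (x k)))"

locale discrete_bass = finite_ctmc \<Omega> X "bass_rate p q"
  for \<Omega> :: "'w measure" and X :: "real \<Rightarrow> 'w \<Rightarrow> 'v::finite \<Rightarrow> bool"
    and p :: "'v \<Rightarrow> real" and q :: "'v \<Rightarrow> 'v \<Rightarrow> real" +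
  assumes external_nonneg: "p j \<ge> 0"
    and internal_nonneg: "i \<noteq> j \<Longrightarrow> q i j \<ge> 0"
    and no_initial_adopters: "\<omega> \<in> space \<Omega> \<Longrightarrow> \<not> X 0 \<omega> j"
    and adopters_remain: "\<omega> \<in> space \<Omega> \<Longrightarrow> 0 \<le> s \<Longrightarrow> s \<le> t \<Longrightarrow> X s \<omega> j \<Longrightarrow> X t \<omega> j"

definition adopter_fraction :: "'w measure \<Rightarrow> (real \<Rightarrow> 'w \<Rightarrow> 'v::finite \<Rightarrow> bool) \<Rightarrow> real \<Rightarrow> real" where
  "adopter_fraction \<Omega> X t = 1 / real CARD('v) * (\<integral>\<omega>. (\<Sum>j\<in>UNIV. of_bool (X t \<omega> j)) \<partial>\<Omega>)"

end

theory Submission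
  imports Defs
begin

text \<open>
  For a chain with generator \<open>A\<close>, conditioning on the state at the earlier of two times gives
  Dynkin's formula \<open>d/dt E[g(X t)] = E[(A g)(X t)]\<close>, also as a left derivative. On the
  homogeneous complete network, \<open>A\<close> maps functions of the number of adopters to functions of
  that number, so three applications of \<open>A\<close> to \<open>n \<mapsto> n / M\<close>, evaluated at the initial state
  \<open>n = 0\<close>, give the three derivatives.
\<close>

lemma (in prob_space) expectation_finite_valued:
  fixes Z :: "'a \<Rightarrow> 'b::finite" and g :: "'b \<Rightarrow> real"
  assumes "Z \<in> M \<rightarrow>\<^sub>M count_space UNIV"
  shows "expectation (\<lambda>\<omega>. g (Z \<omega>)) = (\<Sum>z\<in>UNIV. prob {\<omega> \<in> space M. Z \<omega> = z} * g z)"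
proof -
  have sets: "{\<omega> \<in> space M. Z \<omega> = z} \<in> events" for z
    using measurable_sets[OF assms, of "{z}"] by (simp add: vimage_def Int_def conj_commute)
  have "expectation (\<lambda>\<omega>. g (Z \<omega>)) =
      expectation (\<lambda>\<omega>. \<Sum>z\<in>UNIV. indicator {\<omega> \<in> space M. Z \<omega> = z} \<omega> * g z)"
    by (intro Bochner_Integration.integral_cong)
      (simp_all add: indicator_def of_bool_def if_distrib[of "\<lambda>a. a * _"] cong: if_cong)
  also have "\<dots> = (\<Sum>z\<in>UNIV. prob {\<omega> \<in> space M. Z \<omega> = z} * g z)"
    using sets by (subst Bochner_Integration.integral_sum)
      (auto simp: emeasure_eq_measure Int_absorb2 intro!: sum.cong)
  finally show ?thesis .
qed

text \<open>This is the usual generator matrix, whose diagonal makes the rows sum to zero, applied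
  to \<open>g\<close>; in the form with differences \<open>g y - g x\<close> the diagonal never
  enters.\<close>

definition ctmc_generator :: "('s::finite \<Rightarrow> 's \<Rightarrow> real) \<Rightarrow> ('s \<Rightarrow> real) \<Rightarrow> 's \<Rightarrow> real" where
  "ctmc_generator r g x = (\<Sum>y | y \<noteq> x. r x y * (g y - g x))"

context finite_ctmc
begin

lemma measurable_two_states:
  assumes "s \<ge> 0" "t \<ge> 0"
  shows "(\<lambda>\<omega>. (X s \<omega>, X t \<omega>)) \<in> \<Omega> \<rightarrow>\<^sub>M count_space UNIV"
proof -
  have "(\<lambda>\<omega>. (X s \<omega>, X t \<omega>)) \<in> \<Omega> \<rightarrow>\<^sub>M count_space UNIV \<Otimes>\<^sub>M count_space UNIV"
    using assms by (intro measurable_Pair measurable_state)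
  also have "(count_space UNIV \<Otimes>\<^sub>M count_space UNIV :: ('s \<times> 's) measure) = count_space UNIV"
    by (subst pair_measure_countable) (auto simp: countable_finite)
  finally show ?thesis .
qed

text \<open>The Markov property with \<open>T\<close> empty, multiplied out. The product form also
  covers states \<open>x\<close> of probability zero at time \<open>s\<close>: there both sides
  vanish, whatever \<open>K h x y\<close> is.\<close>

lemma ex_transition_kernel:
  obtains K :: "real \<Rightarrow> 's \<Rightarrow> 's \<Rightarrow> real"
  where "\<And>s h x y. s \<ge> 0 \<Longrightarrow> h \<ge> 0 \<Longrightarrow>
      prob {\<omega> \<in> space \<Omega>. X s \<omega> = x \<and> X (s + h) \<omega> = y} = prob {\<omega> \<in> space \<Omega>. X s \<omega> = x} * K h x y"
    and "\<And>x y. x \<noteq> y \<Longrightarrow> ((\<lambda>h. K h x y / h) \<longlongrightarrow> r x y) (at_right 0)"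
proof -
  from transition_rates obtain K :: "real \<Rightarrow> 's \<Rightarrow> 's \<Rightarrow> real" where
    cond: "\<forall>s\<ge>0. \<forall>h\<ge>0. \<forall>T z x y. finite T \<longrightarrow> T \<subseteq> {0..s} \<longrightarrow>
        \<P>(\<omega> in \<Omega>. X s \<omega> = x \<and> (\<forall>u\<in>T. X u \<omega> = z u)) > 0 \<longrightarrow>
        \<P>(\<omega> in \<Omega>. X (s + h) \<omega> = y \<bar> X s \<omega> = x \<and> (\<forall>u\<in>T. X u \<omega> = z u)) = K h x y"
    and lim: "\<forall>x y. x \<noteq> y \<longrightarrow> ((\<lambda>h. K h x y / h) \<longlongrightarrow> r x y) (at_right 0)"
    by (elim exE conjE) (rule that)
  show ?thesis
  proof (rule that[OF _ lim[rule_format]])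
    fix s h :: real and x y
    assume nonneg: "s \<ge> 0" "h \<ge> 0"
    let ?S = "{\<omega> \<in> space \<Omega>. X s \<omega> = x}" and ?J = "{\<omega> \<in> space \<Omega>. X s \<omega> = x \<and> X (s + h) \<omega> = y}"
    have S: "?S \<in> events"
      using measurable_sets[OF measurable_state[OF nonneg(1)], of "{x}"]
      by (simp add: vimage_def Int_def conj_commute)
    show "prob ?J = prob ?S * K h x y"
    proof (cases "prob ?S = 0")
      case True
      have "prob ?J \<le> prob ?S"
        using S by (intro finite_measure_mono) auto
      with True show ?thesis
        by (simp add: measure_le_0_iff)
    next
      case False
      then have "prob ?S > 0"
        using measure_nonneg[of \<Omega> ?S] by linarith
      with cond[rule_format, OF nonneg, of "{}" x _ y] False show ?thesis
        by (simp add: cond_prob_def conj_commute field_simps)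
    qed
  qed simp_all
qed

text \<open>An increment of the expectation is an average, over the state at the earlier time, of
  expected changes that are asymptotically linear in the time span. From the right the weights are
  fixed at time \<open>t\<close>; from the left they vary, and their convergence has to be proved as
  well.\<close>

theorem dynkin_formula:
  fixes g :: "'s \<Rightarrow> real"
  assumes "t \<ge> 0"
  shows "((\<lambda>t. expectation (\<lambda>\<omega>. g (X t \<omega>))) has_real_derivative
           expectation (\<lambda>\<omega>. ctmc_generator r g (X t \<omega>))) (at t within {0..})"
proof -
  define \<pi> where "\<pi> s x = prob {\<omega> \<in> space \<Omega>. X s \<omega> = x}" for s x
  have expect: "expectation (\<lambda>\<omega>. g (X s \<omega>)) = (\<Sum>x\<in>UNIV. \<pi> s x * g x)" if "s \<ge> 0" for s g
    unfolding \<pi>_def using that by (intro expectation_finite_valued measurable_state)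
  obtain K where joint: "\<And>s h x y. s \<ge> 0 \<Longrightarrow> h \<ge> 0 \<Longrightarrow>
      prob {\<omega> \<in> space \<Omega>. X s \<omega> = x \<and> X (s + h) \<omega> = y} = \<pi> s x * K h x y"
    and K_lim: "\<And>x y. x \<noteq> y \<Longrightarrow> ((\<lambda>h. K h x y / h) \<longlongrightarrow> r x y) (at_right 0)"
    unfolding \<pi>_def using ex_transition_kernel by blast
  \<comment> \<open>\<open>D g h x\<close> plays the role of the expected change of \<open>g\<close>
    over a span \<open>h\<close> from state \<open>x\<close>. The omitted term \<open>y = x\<close>
    would be zero, so only entries of \<open>K\<close> governed by \<open>K_lim\<close>
    occur.\<close>
  define D where "D g h x = (\<Sum>y | y \<noteq> x. K h x y * (g y - g x))" for g :: "'s \<Rightarrow> real" and h x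
  have D_lim: "((\<lambda>h. D g h x / h) \<longlongrightarrow> ctmc_generator r g x) (at_right 0)" for g x
    unfolding D_def ctmc_generator_def sum_divide_distrib times_divide_eq_left[symmetric]
    by (intro tendsto_sum tendsto_mult tendsto_const K_lim) auto
  have D_lim0: "((\<lambda>h. D g h x) \<longlongrightarrow> 0) (at_right 0)" for g x
  proof -
    have "((\<lambda>h. D g h x / h * h) \<longlongrightarrow> ctmc_generator r g x * 0) (at_right 0)"
      by (intro tendsto_mult D_lim tendsto_ident_at)
    then have "((\<lambda>h. D g h x / h * h) \<longlongrightarrow> 0) (at_right 0)"
      by simp
    then show ?thesis
      by (rule Lim_transform_eventually) (rule eventually_mono[OF eventually_at_right_less], simp)
  qed
  \<comment> \<open>Both expectations are computed from the joint law of the states at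
    \<open>s\<close> and \<open>u\<close>. Their difference is then a single sum, and the row sums
    of \<open>K\<close> never enter.\<close>
  have increment: "expectation (\<lambda>\<omega>. g (X u \<omega>)) - expectation (\<lambda>\<omega>. g (X s \<omega>)) =
      (\<Sum>x\<in>UNIV. \<pi> s x * D g (u - s) x)" if "0 \<le> s" "s \<le> u" for s u and g :: "'s \<Rightarrow> real"
  proof -
    from that have "u \<ge> 0" by simp
    have prob: "prob {\<omega> \<in> space \<Omega>. (X s \<omega>, X u \<omega>) = z} = \<pi> s (fst z) * K (u - s) (fst z) (snd z)" for z
      using joint[of s "u - s" "fst z" "snd z"] that by (cases z) simp
    note pair = expectation_finite_valued[OF measurable_two_states[OF \<open>0 \<le> s\<close> \<open>u \<ge> 0\<close>], unfolded prob]
    have "expectation (\<lambda>\<omega>. g (X u \<omega>)) - expectation (\<lambda>\<omega>. g (X s \<omega>)) =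
        (\<Sum>z\<in>UNIV. \<pi> s (fst z) * K (u - s) (fst z) (snd z) * (g (snd z) - g (fst z)))"
      using pair[of "\<lambda>z. g (snd z)"] pair[of "\<lambda>z. g (fst z)"]
      by (simp add: right_diff_distrib sum_subtractf)
    also have "\<dots> = (\<Sum>x\<in>UNIV. \<pi> s x * (\<Sum>y\<in>UNIV. K (u - s) x y * (g y - g x)))"
      unfolding UNIV_Times_UNIV[symmetric] sum.cartesian_product' by (simp add: sum_distrib_left mult.assoc)
    also have "\<dots> = (\<Sum>x\<in>UNIV. \<pi> s x * D g (u - s) x)"
      unfolding D_def by (intro sum.cong arg_cong2[where f = "(*)"] refl sum.mono_neutral_right) auto
    finally show ?thesis .
  qed
  define F where "F = at t within {0..}"
  have ev: "eventually (\<lambda>u. u \<ge> 0 \<and> u \<noteq> t) F"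
    unfolding F_def by (auto simp: eventually_at_filter)
  \<comment> \<open>With \<open>min u t\<close> as the earlier time and
    \<open>\<bar>u - t\<bar>\<close> as the span, one limit along \<open>F\<close> handles
    \<open>u < t\<close> and \<open>u > t\<close> together.\<close>
  have span: "filterlim (\<lambda>u. \<bar>u - t\<bar>) (at_right 0) F"
  proof (rule tendsto_imp_filterlim_at_right)
    have "((\<lambda>u. \<bar>u - t\<bar>) \<longlongrightarrow> \<bar>t - t\<bar>) F"
      unfolding F_def by (intro tendsto_intros)
    then show "((\<lambda>u. \<bar>u - t\<bar>) \<longlongrightarrow> 0) F" by simp
  qed (use ev in \<open>auto elim: eventually_mono\<close>)
  \<comment> \<open>Only \<open>u < t\<close> needs an argument. There \<open>increment\<close> is
    applied to the indicator of \<open>x\<close>; as the weights are probabilities, the change is at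
    most a finite sum of terms that vanish by \<open>D_lim0\<close>.\<close>
  have \<pi>_lim: "((\<lambda>u. \<pi> (min u t) x) \<longlongrightarrow> \<pi> t x) F" for x
  proof (rule Lim_null[THEN iffD2], rule Lim_null_comparison)
    let ?e = "\<lambda>y. of_bool (y = x) :: real"
    have "((\<lambda>u. \<Sum>z\<in>UNIV. \<bar>D ?e \<bar>u - t\<bar> z\<bar>) \<longlongrightarrow> (\<Sum>z\<in>(UNIV::'s set). \<bar>0\<bar>)) F"
      by (intro tendsto_sum tendsto_rabs filterlim_compose[OF D_lim0 span])
    then show "((\<lambda>u. \<Sum>z\<in>UNIV. \<bar>D ?e \<bar>u - t\<bar> z\<bar>) \<longlongrightarrow> 0) F" by simp
    show "\<forall>\<^sub>F u in F. norm (\<pi> (min u t) x - \<pi> t x) \<le> (\<Sum>z\<in>UNIV. \<bar>D ?e \<bar>u - t\<bar> z\<bar>)"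
    proof (rule eventually_mono[OF ev])
      fix u assume u: "u \<ge> 0 \<and> u \<noteq> t"
      show "norm (\<pi> (min u t) x - \<pi> t x) \<le> (\<Sum>z\<in>UNIV. \<bar>D ?e \<bar>u - t\<bar> z\<bar>)"
      proof (cases "u \<le> t")
        case True
        have "expectation (\<lambda>\<omega>. ?e (X s \<omega>)) = \<pi> s x" if "s \<ge> 0" for s
          using expect[OF that, of ?e] by simp
        then have "\<pi> t x - \<pi> u x = (\<Sum>z\<in>UNIV. \<pi> u z * D ?e (t - u) z)"
          using increment[of u t ?e] u True assms by metis
        then have "\<bar>\<pi> u x - \<pi> t x\<bar> = \<bar>\<Sum>z\<in>UNIV. \<pi> u z * D ?e (t - u) z\<bar>"
          by (metis abs_minus_commute)
        also have "\<dots> \<le> (\<Sum>z\<in>UNIV. \<bar>\<pi> u z * D ?e (t - u) z\<bar>)"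
          by (rule sum_abs)
        also have "\<dots> \<le> (\<Sum>z\<in>UNIV. \<bar>D ?e (t - u) z\<bar>)"
          by (intro sum_mono) (auto simp: abs_mult \<pi>_def intro: mult_left_le_one_le)
        finally show ?thesis using True by (simp add: abs_minus_commute)
      qed (simp add: sum_nonneg)
    qed
  qed
  have "((\<lambda>u. \<Sum>x\<in>UNIV. \<pi> (min u t) x * (D g \<bar>u - t\<bar> x / \<bar>u - t\<bar>)) \<longlongrightarrow>
      (\<Sum>x\<in>UNIV. \<pi> t x * ctmc_generator r g x)) F"
    by (intro tendsto_sum tendsto_mult \<pi>_lim filterlim_compose[OF D_lim span])
  then have "((\<lambda>u. (expectation (\<lambda>\<omega>. g (X u \<omega>)) - expectation (\<lambda>\<omega>. g (X t \<omega>))) / (u - t)) \<longlongrightarrow>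
      (\<Sum>x\<in>UNIV. \<pi> t x * ctmc_generator r g x)) F"
  proof (rule Lim_transform_eventually, intro eventually_mono[OF ev])
    fix u assume u: "u \<ge> 0 \<and> u \<noteq> t"
    show "(\<Sum>x\<in>UNIV. \<pi> (min u t) x * (D g \<bar>u - t\<bar> x / \<bar>u - t\<bar>)) =
        (expectation (\<lambda>\<omega>. g (X u \<omega>)) - expectation (\<lambda>\<omega>. g (X t \<omega>))) / (u - t)"
    \<comment> \<open>For \<open>u < t\<close> the increment runs from \<open>u\<close> to
      \<open>t\<close>; numerator and denominator both change sign, so the difference quotient is
      the same.\<close>
    proof (cases "u \<le> t")
      case True
      have "(\<Sum>x\<in>UNIV. \<pi> u x * (D g (t - u) x / (t - u))) =
          (expectation (\<lambda>\<omega>. g (X t \<omega>)) - expectation (\<lambda>\<omega>. g (X u \<omega>))) / (t - u)"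
        using increment[of u t g] True u by (simp add: sum_divide_distrib)
      also have "\<dots> = (expectation (\<lambda>\<omega>. g (X u \<omega>)) - expectation (\<lambda>\<omega>. g (X t \<omega>))) / (u - t)"
        by (metis minus_diff_eq minus_divide_divide)
      finally show ?thesis using True by simp
    next
      case False
      then show ?thesis
        using increment[of t u g] assms by (simp add: sum_divide_distrib)
    qed
  qed
  then show ?thesis
    using expect[OF assms] by (simp add: has_field_derivative_iff F_def)
qed

end

text \<open>After swapping the sums over target states and nodes, each nonadopter \<open>j\<close>
  selects the single target \<open>x(j := True)\<close>.\<close>

lemma generator_bass_rate:
  "ctmc_generator (bass_rate p q) g x =
     (\<Sum>j | \<not> x j. (p j + (\<Sum>k | k \<noteq> j. q k j * of_bool (x k))) * (g (x(j := True)) - g x))"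
proof -
  let ?R = "\<lambda>j. p j + (\<Sum>k | k \<noteq> j. q k j * of_bool (x k))"
  have "ctmc_generator (bass_rate p q) g x =
      (\<Sum>y\<in>UNIV. bass_rate p q x y * (g y - g x))"
    unfolding ctmc_generator_def by (intro sum.mono_neutral_left) auto
  also have "\<dots> = (\<Sum>y\<in>UNIV. \<Sum>j | \<not> x j. if y = x(j := True) then ?R j * (g y - g x) else 0)"
    unfolding bass_rate_def sum_distrib_right
    by (intro sum.cong refl sum.mono_neutral_cong_left) auto
  also have "\<dots> = (\<Sum>j | \<not> x j. ?R j * (g (x(j := True)) - g x))"
    by (subst sum.swap) (simp add: sum.delta)
  finally show ?thesis .
qed

text \<open>The generator of a pure birth chain: each of the \<open>M - n\<close> nonadopters adopts
  at the same rate. Real arguments make iteration plain field algebra; the factor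
  \<open>M - n\<close> removes the value of \<open>G\<close> beyond the full network.\<close>

definition count_generator :: "real \<Rightarrow> real \<Rightarrow> real \<Rightarrow> (real \<Rightarrow> real) \<Rightarrow> real \<Rightarrow> real" where
  "count_generator M p q G n = (M - n) * (p + q / (M - 1) * n) * (G (n + 1) - G n)"

text \<open>By symmetry all nonadopters contribute the same summand: their rates agree, and any
  adoption raises the count by one.\<close>

lemma generator_homogeneous_complete:
  fixes ps :: "'v::finite \<Rightarrow> real"
  assumes "\<And>j. ps j = p"
    and "\<And>i j. i \<noteq> j \<Longrightarrow> qs i j = q / (real CARD('v) - 1)"
  shows "ctmc_generator (bass_rate ps qs) (\<lambda>x. G (real (card {j. x j}))) =
      (\<lambda>x. count_generator (real CARD('v)) p q G (real (card {j. x j})))"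
proof
  fix x :: "'v \<Rightarrow> bool"
  let ?n = "real (card {j. x j})" and ?c = "q / (real CARD('v) - 1)"
  have "(ps j + (\<Sum>k | k \<noteq> j. qs k j * of_bool (x k))) *
      (G (real (card {i. (x(j := True)) i})) - G ?n) = (p + ?c * ?n) * (G (?n + 1) - G ?n)"
    if "\<not> x j" for j
  proof -
    \<comment> \<open>Since \<open>j\<close> is a nonadopter, excluding it from the sum loses no
      adopter.\<close>
    have "(\<Sum>k | k \<noteq> j. qs k j * of_bool (x k)) = (\<Sum>k | x k. ?c)"
      using that by (intro sum.mono_neutral_cong_right) (auto intro: assms(2))
    moreover have "{i. (x(j := True)) i} = insert j {i. x i}" by auto
    ultimately show ?thesis using that assms(1) by (simp add: add.commute mult.commute)
  qed
  then have "ctmc_generator (bass_rate ps qs) (\<lambda>x. G (real (card {j. x j}))) x =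
      (\<Sum>j | \<not> x j. (p + ?c * ?n) * (G (?n + 1) - G ?n))"
    unfolding generator_bass_rate by (intro sum.cong refl) blast
  also have "\<dots> = real (card {j. \<not> x j}) * ((p + ?c * ?n) * (G (?n + 1) - G ?n))"
    by simp
  also have "real (card {j. \<not> x j}) = real CARD('v) - ?n"
    using card_Diff_subset[of "{j. x j}" UNIV] card_mono[of UNIV "{j. x j}"]
    by (simp add: of_nat_diff Compl_eq_Diff_UNIV[symmetric] Compl_eq)
  finally show "ctmc_generator (bass_rate ps qs) (\<lambda>x. G (real (card {j. x j}))) x =
      count_generator (real CARD('v)) p q G ?n"
    by (simp add: count_generator_def mult.assoc)
qed

theorem corollary2:
  fixes \<Omega> :: "'w measure"
    and X :: "real \<Rightarrow> 'w \<Rightarrow> 'v::finite \<Rightarrow> bool"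
    and ps :: "'v \<Rightarrow> real" and qs :: "'v \<Rightarrow> 'v \<Rightarrow> real"
    and p q :: real and M :: nat and f :: "real \<Rightarrow> real"
  assumes "M = CARD('v)" and "M \<ge> 2"
    and "discrete_bass \<Omega> X ps qs"
    and "\<And>j. ps j = p"
    and "\<And>i j. i \<noteq> j \<Longrightarrow> qs i j = q / (real M - 1)"
    and "f = adopter_fraction \<Omega> X"
  shows "\<exists>f' f'' f''' :: real \<Rightarrow> real.
     (\<forall>t\<ge>0. (f has_real_derivative f' t) (at t within {0..})
           \<and> (f' has_real_derivative f'' t) (at t within {0..})
           \<and> (f'' has_real_derivative f''' t) (at t within {0..}))
     \<and> f' 0 = p
     \<and> f'' 0 = p * (q - p)
     \<and> f''' 0 = p * (p\<^sup>2 - 4 * p * q + (real M - 3) / (real M - 1) * q\<^sup>2)"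
proof -
  interpret discrete_bass \<Omega> X ps qs by fact
  \<comment> \<open>The family \<open>u G\<close> is closed under differentiation: by
    \<open>deriv\<close> the derivative of \<open>u G\<close> is \<open>u (B G)\<close>. Iterates of
    \<open>B\<close> on \<open>G0\<close> thus provide the witnesses for all
    \<open>t \<ge> 0\<close>.\<close>
  define u where "u G t = expectation (\<lambda>\<omega>. G (real (card {j. X t \<omega> j})))" for G :: "real \<Rightarrow> real" and t
  define B where "B = count_generator (real M) p q"
  define G0 where "G0 n = n / real M" for n
  have deriv: "(u G has_real_derivative u (B G) t) (at t within {0..})" if "t \<ge> 0" for G t
    using dynkin_formula[OF that, of "\<lambda>x. G (real (card {j. x j}))"]
      generator_homogeneous_complete[OF assms(4,5)[unfolded assms(1)], where G = G]
    by (simp add: u_def[abs_def] B_def assms(1))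
  have f: "f = u G0"
    by (simp add: fun_eq_iff assms(1,6) adopter_fraction_def u_def G0_def)
  have initial: "u G 0 = G 0" for G
  proof -
    have "{j. X 0 \<omega> j} = {}" if "\<omega> \<in> space \<Omega>" for \<omega>
      using no_initial_adopters[OF that] by simp
    then have "u G 0 = expectation (\<lambda>\<omega>. G 0)"
      unfolding u_def by (intro Bochner_Integration.integral_cong) (simp_all del: Collect_empty_eq)
    then show ?thesis by (simp add: prob_space)
  qed
  \<comment> \<open>In terms of \<open>c\<close>, nonzero because \<open>M \<ge> 2\<close>, the
    remaining claims become polynomial identities once the denominators \<open>c\<close> and
    \<open>c + 1\<close> are cleared.\<close>
  define c where "c = real M - 1"
  have M: "real M = c + 1" "c \<noteq> 0" "c + 1 \<noteq> 0"
    using assms(2) by (auto simp: c_def)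
  have B: "B G n = (c + 1 - n) * (p + q / c * n) * (G (n + 1) - G n)" for G n
    by (simp add: B_def count_generator_def M)
  \<comment> \<open>\<open>G0\<close> has constant increment \<open>1 / M\<close>, so its first
    image is an explicit quadratic in \<open>n\<close>.\<close>
  have B0: "B G0 n = (c + 1 - n) * (p + q / c * n) / (c + 1)" for n
    by (simp add: B G0_def M diff_divide_distrib[symmetric])
  have "B G0 0 = p" using M by (simp add: B0)
  moreover have "B (B G0) 0 = p * (q - p)"
    using M(2,3) unfolding B[of "B G0"] B0
    by (simp add: divide_simps) (simp add: algebra_simps)
  \<comment> \<open>Unfolding the two outer applications at \<open>0\<close> leaves only the values
    of \<open>B G0\<close> at \<open>0\<close>, \<open>1\<close> and \<open>2\<close>.\<close>
  moreover have "B (B (B G0)) 0 = p * (p\<^sup>2 - 4 * p * q + (real M - 3) / (real M - 1) * q\<^sup>2)"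
    using M(2,3) unfolding B[of "B (B G0)"] B[of "B G0"] B0 M(1)
    by (simp add: divide_simps) (simp add: algebra_simps power2_eq_square)
  ultimately show ?thesis
    using deriv by (intro exI[of _ "u (B G0)"] exI[of _ "u (B (B G0))"] exI[of _ "u (B (B (B G0)))"])
      (simp add: f initial)
qed

end
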